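(* The following solutions (cell systems) $W^+$, $W^-$ for the cells of $\mathcal{E}_1^{(12)}$ are inequivalent: for $l=1,2,3$, $$W_{i_l,j_l,k_l}^{\pm}=\sqrt{[2][3]},\qquad W_{p,j_l,k_l}^{\pm}=\sqrt{[3][4]},$$ $$W_{p,j_l,r(\alpha)}^{\pm}=\epsilon_l\sqrt{[2]}\sqrt{[2][4]\pm\sqrt{[2][4]}},\qquad W_{p,j_l,r(\alpha')}^{\pm}=\overline{\epsilon_l}\sqrt{[2]}\sqrt{[2][4]\mp\sqrt{[2][4]}},$$ $$W_{p,q,k_l(\beta)}^{\pm}=\epsilon_l\sqrt{[2]}\sqrt{[2][4]\mp\sqrt{[2][4]}},\qquad W_{p,q,k_l(\beta')}^{\pm}=\overline{\epsilon_l}\sqrt{[2]}\sqrt{[2][4]\pm\sqrt{[2][4]}},$$ $$W_{p,q,r(\alpha\beta')}^{\pm}=\frac{[4]}{\sqrt{[2]}}\sqrt{[2]^2\mp\sqrt{[2][4]}},\qquad W_{p,q,r(\alpha'\beta)}^{\pm}=-\frac{[4]}{\sqrt{[2]}}\sqrt{[2]^2\pm\sqrt{[2][4]}},$$ $$W_{p,q,r(\alpha\beta)}^{\pm}=W_{p,q,r(\alpha'\beta')}^{\pm}=0,$$ where $\epsilon_1=1$ and $\epsilon_2=e^{2\pi i/3}=\overline{\epsilon_3}$.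
   Context: Let $q=e^{\pi i/12}$ and $[m]=(q^m-q^{-m})/(q-q^{-1})$ (this $q$ is not to be confused with the vertex $q$ below). The graph $\mathcal{E}_1^{(12)}$ has vertices $i_l,j_l,k_l$ ($l=1,2,3$) and $p,q,r$, and exactly the following edges: for each $l$ one edge $i_l\to j_l$, $j_l\to k_l$, $k_l\to i_l$, $p\to j_l$, $k_l\to p$, $j_l\to r$, $q\to k_l$; one edge $q\to r$; two edges $\alpha,\alpha'$ from $r$ to $p$; two edges $\beta,\beta'$ from $p$ to $q$. Its Perron-Frobenius eigenvector (eigenvalue $[3]$) is $\phi_{i_l}=1$, $\phi_{j_l}=\phi_{k_l}=[3]$, $\phi_p=[2][4]$, $\phi_q=\phi_r=[3][4]/[2]$. $W_{a,b,c}$ denotes the value of $W$ on the triangle $a\to b\to c\to a$; the letters in parentheses specify which of the double edges is (are) used, e.g. $W_{p,q,r(\alpha\beta')}$ is for $p\xrightarrow{\beta'}q\to r\xrightarrow{\alpha}p$. Cell systems: let $\mathcal{G}$ be a directed graph (loops and multiple edges allowed), with source and range maps $s,r$, Perron-Frobenius eigenvalue $[3]$ and positive Perron-Frobenius eigenvector $(\phi_i)$. A triangle $\triangle_{ijk}^{(\alpha\beta\gamma)}$ is a closed path $i\xrightarrow{\alpha}j\xrightarrow{\beta}k\xrightarrow{\gamma}i$ ($i,j,k$ arbitrary vertices, $\alpha,\beta,\gamma$ arbitrary edges), considered up to cyclic rotation. A cell system $W$ assigns to each triangle a complex number $W(\triangle_{ijk}^{(\alpha\beta\gamma)})$ such that: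 (I) for all edges $\alpha,\alpha'$ from $i$ to $j$, $\sum_{k,\beta,\gamma}W(\triangle_{ijk}^{(\alpha\beta\gamma)})\overline{W(\triangle_{ijk}^{(\alpha'\beta\gamma)})}=\delta_{\alpha,\alpha'}[2]\phi_i\phi_j$, the sum being over vertices $k$ and edges $\beta:j\to k$, $\gamma:k\to i$; (II) for all edges $\alpha_1,\dots,\alpha_4$ with $s(\alpha_1)=s(\alpha_4)=i_1$, $r(\alpha_1)=r(\alpha_2)=i_2$, $s(\alpha_2)=s(\alpha_3)=i_3$, $r(\alpha_3)=r(\alpha_4)=i_4$ (here $i_1,\dots,i_4$ are arbitrary vertices of $\mathcal{G}$), $$\sum\phi_k^{-1}W(\triangle_{i_1i_2k}^{(\alpha_1\beta_1\beta_2)})\overline{W(\triangle_{i_3i_2k}^{(\alpha_2\beta_1\beta_3)})}W(\triangle_{i_3i_4k}^{(\alpha_3\beta_4\beta_3)})\overline{W(\triangle_{i_1i_4k}^{(\alpha_4\beta_4\beta_2)})}=\delta_{\alpha_1,\alpha_4}\delta_{\alpha_2,\alpha_3}\phi_{i_1}\phi_{i_2}\phi_{i_3}+\delta_{\alpha_1,\alpha_2}\delta_{\alpha_3,\alpha_4}\phi_{i_1}\phi_{i_2}\phi_{i_4},$$ the sum being over vertices $k$ and edges $\beta_1:i_2\to k$, $\beta_2:k\to i_1$, $\beta_3:k\to i_3$, $\beta_4:i_4\to k$. Two cell systems $W_1,W_2$ on $\mathcal{G}$ are equivalent if for each pair of adjacent vertices $i,j$ there is a unitary matrix $(u(\sigma,\sigma'))$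 indexed by the edges from $i$ to $j$ such that for every triangle $W_1(\triangle_{ijk}^{(\sigma\rho\gamma)})=\sum_{\sigma',\rho',\gamma'}u(\sigma,\sigma')u(\rho,\rho')u(\gamma,\gamma')W_2(\triangle_{ijk}^{(\sigma'\rho'\gamma')})$, summing over edges $\sigma':i\to j$, $\rho':j\to k$, $\gamma':k\to i$. *)

theory Defs
  imports "HOL-Analysis.Analysis" "Graph_Theory.Digraph"
begin

section \<open>Quantum integers\<close>

definition qpar :: complex where
  "qpar = exp (\<i> * of_real pi / 12)"

text \<open>The quantum integers at this root of unity are real; the real part is taken only to obtain
  a value of type \<^typ>\<open>real\<close>, and \<open>of_real_qint\<close> shows that nothing is lost.\<close>

definition qint :: "nat \<Rightarrow> real" where
  "qint m = Re ((qpar ^ m - inverse qpar ^ m) / (qpar - inverse qpar))"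

lemma of_real_qint:
  "complex_of_real (qint m) = (qpar ^ m - inverse qpar ^ m) / (qpar - inverse qpar)"
proof -
  have q: "qpar = cis (pi / 12)"
    by (simp add: qpar_def cis_conv_exp)
  have *: "qpar ^ n - inverse qpar ^ n = 2 * \<i> * of_real (sin (n * pi / 12))" for n
  proof -
    have "qpar ^ n - inverse qpar ^ n = cis (n * pi / 12) - cis (- (n * pi / 12))"
      by (simp only: q cis_inverse Complex.DeMoivre) simp
    then show ?thesis
      by (simp add: complex_eq_iff)
  qed
  have "(qpar ^ m - inverse qpar ^ m) / (qpar - inverse qpar)
      = of_real (sin (m * pi / 12) / sin (pi / 12))"
    using *[of m] *[of 1] by simp
  then show ?thesis
    by (simp add: qint_def)
qed


section \<open>Cell systems on directed graphs\<close>

definition edges :: "('v, 'e) pre_digraph \<Rightarrow> 'v \<Rightarrow> 'v \<Rightarrow> 'e set" where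
  "edges G i j = {e \<in> arcs G. tail G e = i \<and> head G e = j}"

definition adj_eigenvector ::
  "('v, 'e) pre_digraph \<Rightarrow> 'a::real_normed_field \<Rightarrow> ('v \<Rightarrow> 'a) \<Rightarrow> bool" where
  "adj_eigenvector G \<mu> v \<longleftrightarrow>
     (\<exists>i\<in>verts G. v i \<noteq> 0) \<and>
     (\<forall>i\<in>verts G. (\<Sum>j\<in>verts G. of_nat (card (edges G i j)) * v j) = \<mu> * v i)"

text \<open>A positive eigenvector whose eigenvalue is the spectral radius of the adjacency matrix.\<close>

definition perron_frobenius ::
  "('v, 'e) pre_digraph \<Rightarrow> real \<Rightarrow> ('v \<Rightarrow> real) \<Rightarrow> bool" where
  "perron_frobenius G d \<phi> \<longleftrightarrow>
     adj_eigenvector G d \<phi> \<and> (\<forall>i\<in>verts G. \<phi> i > 0) \<and>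
     (\<forall>(\<mu>::complex) v. adj_eigenvector G \<mu> v \<longrightarrow> cmod \<mu> \<le> d)"

definition triangle :: "('v, 'e) pre_digraph \<Rightarrow> 'e \<Rightarrow> 'e \<Rightarrow> 'e \<Rightarrow> bool" where
  "triangle G \<alpha> \<beta> \<gamma> \<longleftrightarrow> (\<exists>i\<in>verts G. \<exists>j\<in>verts G. \<exists>k\<in>verts G.
     \<alpha> \<in> edges G i j \<and> \<beta> \<in> edges G j k \<and> \<gamma> \<in> edges G k i)"

text \<open>A triangle is determined by its three edges, so a cell system is a function
  \<open>W \<alpha> \<beta> \<gamma>\<close> of three edges. Only its values on triangles matter; that triangles are taken up to
  rotation is \<open>rotation_invariant\<close>.\<close>

type_synonym 'e cells = "'e \<Rightarrow> 'e \<Rightarrow> 'e \<Rightarrow> complex"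

definition rotation_invariant :: "('v, 'e) pre_digraph \<Rightarrow> 'e cells \<Rightarrow> bool" where
  "rotation_invariant G W \<longleftrightarrow>
     (\<forall>\<alpha> \<beta> \<gamma>. triangle G \<alpha> \<beta> \<gamma> \<longrightarrow> W \<alpha> \<beta> \<gamma> = W \<beta> \<gamma> \<alpha>)"

definition type_I :: "('v, 'e) pre_digraph \<Rightarrow> ('v \<Rightarrow> real) \<Rightarrow> 'e cells \<Rightarrow> bool" where
  "type_I G \<phi> W \<longleftrightarrow>
     (\<forall>i\<in>verts G. \<forall>j\<in>verts G. \<forall>\<alpha>\<in>edges G i j. \<forall>\<alpha>'\<in>edges G i j.
        (\<Sum>k\<in>verts G. \<Sum>\<beta>\<in>edges G j k. \<Sum>\<gamma>\<in>edges G k i. W \<alpha> \<beta> \<gamma> * cnj (W \<alpha>' \<beta> \<gamma>))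
        = (if \<alpha> = \<alpha>' then of_real (qint 2 * \<phi> i * \<phi> j) else 0))"

definition type_II :: "('v, 'e) pre_digraph \<Rightarrow> ('v \<Rightarrow> real) \<Rightarrow> 'e cells \<Rightarrow> bool" where
  "type_II G \<phi> W \<longleftrightarrow>
     (\<forall>i1\<in>verts G. \<forall>i2\<in>verts G. \<forall>i3\<in>verts G. \<forall>i4\<in>verts G.
      \<forall>\<alpha>1\<in>edges G i1 i2. \<forall>\<alpha>2\<in>edges G i3 i2. \<forall>\<alpha>3\<in>edges G i3 i4. \<forall>\<alpha>4\<in>edges G i1 i4.
        (\<Sum>k\<in>verts G. \<Sum>\<beta>1\<in>edges G i2 k. \<Sum>\<beta>2\<in>edges G k i1.
           \<Sum>\<beta>3\<in>edges G k i3. \<Sum>\<beta>4\<in>edges G i4 k.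
             of_real (inverse (\<phi> k)) * W \<alpha>1 \<beta>1 \<beta>2 * cnj (W \<alpha>2 \<beta>1 \<beta>3)
               * W \<alpha>3 \<beta>4 \<beta>3 * cnj (W \<alpha>4 \<beta>4 \<beta>2))
        = (if \<alpha>1 = \<alpha>4 \<and> \<alpha>2 = \<alpha>3 then of_real (\<phi> i1 * \<phi> i2 * \<phi> i3) else 0)
        + (if \<alpha>1 = \<alpha>2 \<and> \<alpha>3 = \<alpha>4 then of_real (\<phi> i1 * \<phi> i2 * \<phi> i4) else 0))"

definition cell_system :: "('v, 'e) pre_digraph \<Rightarrow> ('v \<Rightarrow> real) \<Rightarrow> 'e cells \<Rightarrow> bool" where
  "cell_system G \<phi> W \<longleftrightarrow>
     fin_digraph G \<and> perron_frobenius G (qint 3) \<phi> \<and>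
     rotation_invariant G W \<and> type_I G \<phi> W \<and> type_II G \<phi> W"

definition unitary_on :: "'e set \<Rightarrow> ('e \<Rightarrow> 'e \<Rightarrow> complex) \<Rightarrow> bool" where
  "unitary_on E u \<longleftrightarrow>
     (\<forall>\<sigma>\<in>E. \<forall>\<sigma>'\<in>E. (\<Sum>\<tau>\<in>E. u \<sigma> \<tau> * cnj (u \<sigma>' \<tau>)) = (if \<sigma> = \<sigma>' then 1 else 0)) \<and>
     (\<forall>\<sigma>\<in>E. \<forall>\<sigma>'\<in>E. (\<Sum>\<tau>\<in>E. cnj (u \<tau> \<sigma>) * u \<tau> \<sigma>') = (if \<sigma> = \<sigma>' then 1 else 0))"

text \<open>For non-adjacent vertices the matrix \<open>u i j\<close> is indexed by the empty set and irrelevant.\<close>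

definition cells_equivalent :: "('v, 'e) pre_digraph \<Rightarrow> 'e cells \<Rightarrow> 'e cells \<Rightarrow> bool" where
  "cells_equivalent G W1 W2 \<longleftrightarrow>
     (\<exists>u :: 'v \<Rightarrow> 'v \<Rightarrow> 'e \<Rightarrow> 'e \<Rightarrow> complex.
        (\<forall>i\<in>verts G. \<forall>j\<in>verts G. unitary_on (edges G i j) (u i j)) \<and>
        (\<forall>i\<in>verts G. \<forall>j\<in>verts G. \<forall>k\<in>verts G.
         \<forall>\<sigma>\<in>edges G i j. \<forall>\<rho>\<in>edges G j k. \<forall>\<gamma>\<in>edges G k i.
           W1 \<sigma> \<rho> \<gamma> =
           (\<Sum>\<sigma>'\<in>edges G i j. \<Sum>\<rho>'\<in>edges G j k. \<Sum>\<gamma>'\<in>edges G k i.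
              u i j \<sigma> \<sigma>' * u j k \<rho> \<rho>' * u k i \<gamma> \<gamma>' * W2 \<sigma>' \<rho>' \<gamma>')))"


section \<open>The graph $\mathcal{E}_1^{(12)}$\<close>

datatype idx = L1 | L2 | L3

datatype vertex = VI idx | VJ idx | VK idx | VP | VQ | VR

datatype edge =
    IJ idx | JK idx | KI idx | PJ idx | KP idx | JR idx | QK idx | QR
  | Alpha | Alpha' | Beta | Beta'

primrec edge_tail :: "edge \<Rightarrow> vertex" where
  "edge_tail (IJ l) = VI l"
| "edge_tail (JK l) = VJ l"
| "edge_tail (KI l) = VK l"
| "edge_tail (PJ l) = VP"
| "edge_tail (KP l) = VK l"
| "edge_tail (JR l) = VJ l"
| "edge_tail (QK l) = VQ"
| "edge_tail QR = VQ"
| "edge_tail Alpha = VR"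
| "edge_tail Alpha' = VR"
| "edge_tail Beta = VP"
| "edge_tail Beta' = VP"

primrec edge_head :: "edge \<Rightarrow> vertex" where
  "edge_head (IJ l) = VJ l"
| "edge_head (JK l) = VK l"
| "edge_head (KI l) = VI l"
| "edge_head (PJ l) = VJ l"
| "edge_head (KP l) = VP"
| "edge_head (JR l) = VR"
| "edge_head (QK l) = VK l"
| "edge_head QR = VR"
| "edge_head Alpha = VP"
| "edge_head Alpha' = VP"
| "edge_head Beta = VQ"
| "edge_head Beta' = VQ"

definition E1_12 :: "(vertex, edge) pre_digraph" where
  "E1_12 = \<lparr>verts = UNIV, arcs = UNIV, tail = edge_tail, head = edge_head\<rparr>"

primrec E1_phi :: "vertex \<Rightarrow> real" where
  "E1_phi (VI l) = 1"
| "E1_phi (VJ l) = qint 3"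
| "E1_phi (VK l) = qint 3"
| "E1_phi VP = qint 2 * qint 4"
| "E1_phi VQ = qint 3 * qint 4 / qint 2"
| "E1_phi VR = qint 3 * qint 4 / qint 2"


section \<open>The two families of cells\<close>

primrec eps :: "idx \<Rightarrow> complex" where
  "eps L1 = 1"
| "eps L2 = exp (2 * of_real pi * \<i> / 3)"
| "eps L3 = cnj (exp (2 * of_real pi * \<i> / 3))"

text \<open>The sign \<open>s\<close> is \<open>1\<close> for $W^+$ and \<open>-1\<close> for $W^-$. Each triangle is given in one rotation
  only; the two other rotations of each pattern below fall under the final case.\<close>

definition E1_base :: "real \<Rightarrow> edge cells" where
  "E1_base s a b c = (case (a, b, c) of
     (IJ l, JK _, KI _) \<Rightarrow> of_real (sqrt (qint 2 * qint 3))
   | (PJ l, JK _, KP _) \<Rightarrow> of_real (sqrt (qint 3 * qint 4))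
   | (PJ l, JR _, Alpha) \<Rightarrow>
       eps l * of_real (sqrt (qint 2) * sqrt (qint 2 * qint 4 + s * sqrt (qint 2 * qint 4)))
   | (PJ l, JR _, Alpha') \<Rightarrow>
       cnj (eps l) * of_real (sqrt (qint 2) * sqrt (qint 2 * qint 4 - s * sqrt (qint 2 * qint 4)))
   | (Beta, QK l, KP _) \<Rightarrow>
       eps l * of_real (sqrt (qint 2) * sqrt (qint 2 * qint 4 - s * sqrt (qint 2 * qint 4)))
   | (Beta', QK l, KP _) \<Rightarrow>
       cnj (eps l) * of_real (sqrt (qint 2) * sqrt (qint 2 * qint 4 + s * sqrt (qint 2 * qint 4)))
   | (Beta', QR, Alpha) \<Rightarrow>
       of_real (qint 4 / sqrt (qint 2) * sqrt ((qint 2)\<^sup>2 - s * sqrt (qint 2 * qint 4)))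
   | (Beta, QR, Alpha') \<Rightarrow>
       - of_real (qint 4 / sqrt (qint 2) * sqrt ((qint 2)\<^sup>2 + s * sqrt (qint 2 * qint 4)))
   | _ \<Rightarrow> 0)"

text \<open>At most one summand is nonzero, so this is the rotation-invariant extension.\<close>

definition E1_cells :: "real \<Rightarrow> edge cells" where
  "E1_cells s a b c = E1_base s a b c + E1_base s b c a + E1_base s c a b"

definition W_plus :: "edge cells" where
  "W_plus = E1_cells 1"

definition W_minus :: "edge cells" where
  "W_minus = E1_cells (- 1)"

lemma E1_cells_rotate: "E1_cells s a b c = E1_cells s b c a"
  by (simp add: E1_cells_def)

lemma E1_cells_values:
  "E1_cells s (IJ l) (JK l) (KI l) = of_real (sqrt (qint 2 * qint 3))"
  "E1_cells s (PJ l) (JK l) (KP l) = of_real (sqrt (qint 3 * qint 4))"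
  "E1_cells s (PJ l) (JR l) Alpha =
     eps l * of_real (sqrt (qint 2) * sqrt (qint 2 * qint 4 + s * sqrt (qint 2 * qint 4)))"
  "E1_cells s (PJ l) (JR l) Alpha' =
     cnj (eps l) * of_real (sqrt (qint 2) * sqrt (qint 2 * qint 4 - s * sqrt (qint 2 * qint 4)))"
  "E1_cells s Beta (QK l) (KP l) =
     eps l * of_real (sqrt (qint 2) * sqrt (qint 2 * qint 4 - s * sqrt (qint 2 * qint 4)))"
  "E1_cells s Beta' (QK l) (KP l) =
     cnj (eps l) * of_real (sqrt (qint 2) * sqrt (qint 2 * qint 4 + s * sqrt (qint 2 * qint 4)))"
  "E1_cells s Beta' QR Alpha =
     of_real (qint 4 / sqrt (qint 2) * sqrt ((qint 2)\<^sup>2 - s * sqrt (qint 2 * qint 4)))"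
  "E1_cells s Beta QR Alpha' =
     - of_real (qint 4 / sqrt (qint 2) * sqrt ((qint 2)\<^sup>2 + s * sqrt (qint 2 * qint 4)))"
  "E1_cells s Beta QR Alpha = 0"
  "E1_cells s Beta' QR Alpha' = 0"
  by (simp_all add: E1_cells_def E1_base_def)

end

theory Submission
  imports Defs
begin

text \<open>
  Write \<open>\<delta> = [2]\<close> and \<open>\<theta> = 3\<^bsup>1/4\<^esup>\<close>. At this root of unity \<open>\<delta>\<^sup>2 = 2 + \<theta>\<^sup>2\<close>, \<open>[3] = 1 + \<theta>\<^sup>2\<close> and
  \<open>[4] = \<delta> \<theta>\<^sup>2\<close>, so that the nested radical \<open>\<surd>([2][4])\<close> is just \<open>\<delta> \<theta>\<close>. Squares of moduli of cells
  then lie in the field generated by \<open>\<delta>\<close> and \<open>\<theta>\<close>, the cells of the two triangles through \<open>p, q, r\<close>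
  become proportional to \<open>\<delta> \<theta> - s\<close> and \<open>\<delta> \<theta> + s\<close>, where \<open>s = \<plusminus>1\<close> is the sign of the solution, and the
  inverse weights \<open>\<phi>\<^sub>k\<^sup>-\<^sup>1\<close> are polynomials in \<open>\<theta>\<^sup>2 = \<surd>3\<close>.

  The equations of type I and II thereby become polynomial identities modulo \<open>\<delta>\<^sup>2 = 2 + \<theta>\<^sup>2\<close>,
  \<open>\<theta>\<^sup>4 = 3\<close>, \<open>s\<^sup>2 = 1\<close> and the relations between cube roots of unity
  (\<open>cell_relations\<close>, \<open>eps_mult_cnj\<close>, \<open>eps_cross\<close>, \<open>eps_L2\<close>). Up to the label \<open>l\<close> there are few kinds of
  squares: two edges out of one vertex, two edges into one vertex, or the four edges between
  \<open>{j\<^sub>l, q}\<close> and \<open>{k\<^sub>l, r}\<close>.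
  The claim that \<open>[3]\<close> is the spectral radius follows from positivity of \<open>\<phi>\<close> alone
  (\<open>positive_eigenvector_dominates\<close>).

  For inequivalence, regard the cells on the triangles through \<open>p, j\<^sub>l, r\<close> as three vectors
  \<open>w\<^sub>l \<in> \<complex>\<^sup>2\<close> indexed by the double edge \<open>\<alpha>, \<alpha>'\<close>. An equivalence applies one unitary matrix to all three
  vectors and multiplies each of them by a phase, because the edges \<open>p \<rightarrow> j\<^sub>l\<close> and \<open>j\<^sub>l \<rightarrow> r\<close> are simple.
  It preserves the cyclic product \<open>\<langle>w\<^sub>1,w\<^sub>2\<rangle>\<langle>w\<^sub>2,w\<^sub>3\<rangle>\<langle>w\<^sub>3,w\<^sub>1\<rangle>\<close>, the Bargmann invariant. All three factors
  equal \<open>z = - \<delta>\<^sup>2 \<theta> (\<delta> \<theta> + \<i> \<surd>3 s)\<close>, so the two solutions have complex conjugate invariants \<open>z\<^sup>3\<close>,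
  and \<open>z\<^sup>3\<close> is not real since \<open>(\<delta> \<theta>)\<^sup>2 \<noteq> 1\<close>.
\<close>

section \<open>General facts on eigenvectors and cell systems\<close>

text \<open>
  Compare \<open>v\<close> with \<open>\<phi>\<close> at a vertex where \<open>|v i| / \<phi> i\<close> is maximal: there the triangle inequality
  bounds \<open>|\<mu>| |v i|\<close> by \<open>d |v i|\<close>.
\<close>

lemma positive_eigenvector_dominates:
  fixes \<phi> :: "'v \<Rightarrow> real" and v :: "'v \<Rightarrow> complex"
  assumes fin: "finite (verts G)"
    and eig: "adj_eigenvector G d \<phi>" and pos: "\<And>i. i \<in> verts G \<Longrightarrow> \<phi> i > 0"
    and eig_v: "adj_eigenvector G \<mu> v"
  shows "cmod \<mu> \<le> d"
proof -
  obtain i0 where i0: "i0 \<in> verts G" "v i0 \<noteq> 0"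
    using eig_v by (auto simp: adj_eigenvector_def)
  define M where "M = Max ((\<lambda>i. cmod (v i) / \<phi> i) ` verts G)"
  have "M \<in> (\<lambda>i. cmod (v i) / \<phi> i) ` verts G"
    unfolding M_def using fin i0 by (intro Max_in) auto
  then obtain i where i: "i \<in> verts G" "M = cmod (v i) / \<phi> i" by auto
  have le: "cmod (v j) \<le> M * \<phi> j" if "j \<in> verts G" for j
  proof -
    have "cmod (v j) / \<phi> j \<le> M" unfolding M_def using fin that by (intro Max_ge) auto
    then show ?thesis using pos[OF that] by (simp add: field_simps)
  qed
  have vi: "cmod (v i) = M * \<phi> i" using i pos[OF i(1)] by simp
  have "0 < cmod (v i0)" using i0 by simp
  also have "\<dots> \<le> M * \<phi> i0" by (rule le[OF i0(1)])
  finally have "M > 0" using pos[OF i0(1)] by (simp add: zero_less_mult_iff)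
  then have vi_pos: "cmod (v i) > 0" using vi pos[OF i(1)] by simp
  have "cmod \<mu> * cmod (v i) = cmod (\<Sum>j\<in>verts G. of_nat (card (edges G i j)) * v j)"
    using eig_v i(1) by (simp add: adj_eigenvector_def norm_mult)
  also have "\<dots> \<le> (\<Sum>j\<in>verts G. of_nat (card (edges G i j)) * cmod (v j))"
    by (rule order_trans[OF norm_sum]) (simp add: norm_mult)
  also have "\<dots> \<le> (\<Sum>j\<in>verts G. of_nat (card (edges G i j)) * (M * \<phi> j))"
    by (intro sum_mono mult_left_mono le) auto
  also have "\<dots> = M * (\<Sum>j\<in>verts G. of_nat (card (edges G i j)) * \<phi> j)"
    by (simp add: sum_distrib_left algebra_simps)
  also have "\<dots> = d * cmod (v i)"
    using eig i(1) vi by (simp add: adj_eigenvector_def)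
  finally show ?thesis using vi_pos by simp
qed

text \<open>
  The equations of type I and II have one instance for each pair of parallel edges and for each closed
  square of edges. Recovering the end points from the edges turns them into predicates on edges,
  which can be checked one configuration at a time.
\<close>

definition loop_relation ::
  "('v, 'e) pre_digraph \<Rightarrow> ('v \<Rightarrow> real) \<Rightarrow> 'e cells \<Rightarrow> 'e \<Rightarrow> 'e \<Rightarrow> bool" where
  "loop_relation G \<phi> W \<alpha> \<alpha>' \<longleftrightarrow>
     (\<Sum>k\<in>verts G. \<Sum>\<beta>\<in>edges G (head G \<alpha>) k. \<Sum>\<gamma>\<in>edges G k (tail G \<alpha>).
        W \<alpha> \<beta> \<gamma> * cnj (W \<alpha>' \<beta> \<gamma>))
     = (if \<alpha> = \<alpha>' then of_real (qint 2 * \<phi> (tail G \<alpha>) * \<phi> (head G \<alpha>)) else 0)"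

definition square_relation ::
  "('v, 'e) pre_digraph \<Rightarrow> ('v \<Rightarrow> real) \<Rightarrow> 'e cells \<Rightarrow> 'e \<Rightarrow> 'e \<Rightarrow> 'e \<Rightarrow> 'e \<Rightarrow> bool" where
  "square_relation G \<phi> W \<alpha>1 \<alpha>2 \<alpha>3 \<alpha>4 \<longleftrightarrow>
     (\<Sum>k\<in>verts G. \<Sum>\<beta>1\<in>edges G (head G \<alpha>1) k. \<Sum>\<beta>2\<in>edges G k (tail G \<alpha>1).
        \<Sum>\<beta>3\<in>edges G k (tail G \<alpha>3). \<Sum>\<beta>4\<in>edges G (head G \<alpha>3) k.
          of_real (inverse (\<phi> k)) * W \<alpha>1 \<beta>1 \<beta>2 * cnj (W \<alpha>2 \<beta>1 \<beta>3)
            * W \<alpha>3 \<beta>4 \<beta>3 * cnj (W \<alpha>4 \<beta>4 \<beta>2))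
     = (if \<alpha>1 = \<alpha>4 \<and> \<alpha>2 = \<alpha>3
        then of_real (\<phi> (tail G \<alpha>1) * \<phi> (head G \<alpha>1) * \<phi> (tail G \<alpha>3)) else 0)
     + (if \<alpha>1 = \<alpha>2 \<and> \<alpha>3 = \<alpha>4
        then of_real (\<phi> (tail G \<alpha>1) * \<phi> (head G \<alpha>1) * \<phi> (head G \<alpha>3)) else 0)"

lemma type_I_if_loop_relations:
  assumes "\<And>\<alpha> \<alpha>'. tail G \<alpha> = tail G \<alpha>' \<Longrightarrow> head G \<alpha> = head G \<alpha>' \<Longrightarrow> loop_relation G \<phi> W \<alpha> \<alpha>'"
  shows "type_I G \<phi> W"
  unfolding type_I_def
proof (intro ballI)
  fix i j \<alpha> \<alpha>'
  assume "\<alpha> \<in> edges G i j" "\<alpha>' \<in> edges G i j"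
  then have e: "i = tail G \<alpha>" "j = head G \<alpha>" "tail G \<alpha> = tail G \<alpha>'" "head G \<alpha> = head G \<alpha>'"
    by (auto simp: edges_def)
  show "(\<Sum>k\<in>verts G. \<Sum>\<beta>\<in>edges G j k. \<Sum>\<gamma>\<in>edges G k i. W \<alpha> \<beta> \<gamma> * cnj (W \<alpha>' \<beta> \<gamma>))
      = (if \<alpha> = \<alpha>' then of_real (qint 2 * \<phi> i * \<phi> j) else 0)"
    unfolding e(1,2) using assms[OF e(3,4)] unfolding loop_relation_def .
qed

lemma type_II_if_square_relations:
  assumes "\<And>\<alpha>1 \<alpha>2 \<alpha>3 \<alpha>4. head G \<alpha>1 = head G \<alpha>2 \<Longrightarrow> tail G \<alpha>2 = tail G \<alpha>3 \<Longrightarrow>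
    head G \<alpha>3 = head G \<alpha>4 \<Longrightarrow> tail G \<alpha>4 = tail G \<alpha>1 \<Longrightarrow> square_relation G \<phi> W \<alpha>1 \<alpha>2 \<alpha>3 \<alpha>4"
  shows "type_II G \<phi> W"
  unfolding type_II_def
proof (intro ballI)
  fix i1 i2 i3 i4 \<alpha>1 \<alpha>2 \<alpha>3 \<alpha>4
  assume "\<alpha>1 \<in> edges G i1 i2" "\<alpha>2 \<in> edges G i3 i2" "\<alpha>3 \<in> edges G i3 i4" "\<alpha>4 \<in> edges G i1 i4"
  then have e: "i1 = tail G \<alpha>1" "i2 = head G \<alpha>1" "i3 = tail G \<alpha>3" "i4 = head G \<alpha>3"
    and sq: "head G \<alpha>1 = head G \<alpha>2" "tail G \<alpha>2 = tail G \<alpha>3" "head G \<alpha>3 = head G \<alpha>4"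
      "tail G \<alpha>4 = tail G \<alpha>1"
    by (auto simp: edges_def)
  show "(\<Sum>k\<in>verts G. \<Sum>\<beta>1\<in>edges G i2 k. \<Sum>\<beta>2\<in>edges G k i1.
           \<Sum>\<beta>3\<in>edges G k i3. \<Sum>\<beta>4\<in>edges G i4 k.
             of_real (inverse (\<phi> k)) * W \<alpha>1 \<beta>1 \<beta>2 * cnj (W \<alpha>2 \<beta>1 \<beta>3)
               * W \<alpha>3 \<beta>4 \<beta>3 * cnj (W \<alpha>4 \<beta>4 \<beta>2))
        = (if \<alpha>1 = \<alpha>4 \<and> \<alpha>2 = \<alpha>3 then of_real (\<phi> i1 * \<phi> i2 * \<phi> i3) else 0)
        + (if \<alpha>1 = \<alpha>2 \<and> \<alpha>3 = \<alpha>4 then of_real (\<phi> i1 * \<phi> i2 * \<phi> i4) else 0)"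
    unfolding e using assms[OF sq] unfolding square_relation_def .
qed

lemma unitary_on_preserves_inner:
  assumes fin: "finite E" and u: "unitary_on E u"
  shows "(\<Sum>\<gamma>\<in>E. (\<Sum>\<tau>\<in>E. u \<gamma> \<tau> * x \<tau>) * cnj (\<Sum>\<tau>\<in>E. u \<gamma> \<tau> * y \<tau>)) = (\<Sum>\<gamma>\<in>E. x \<gamma> * cnj (y \<gamma>))"
proof -
  have "(\<Sum>\<gamma>\<in>E. (\<Sum>\<tau>\<in>E. u \<gamma> \<tau> * x \<tau>) * cnj (\<Sum>\<tau>\<in>E. u \<gamma> \<tau> * y \<tau>))
      = (\<Sum>\<gamma>\<in>E. \<Sum>\<tau>\<in>E. \<Sum>\<tau>'\<in>E. x \<tau> * cnj (y \<tau>') * (cnj (u \<gamma> \<tau>') * u \<gamma> \<tau>))"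
    by (simp add: sum_product cnj_sum algebra_simps)
  also have "\<dots> = (\<Sum>\<tau>\<in>E. \<Sum>\<gamma>\<in>E. \<Sum>\<tau>'\<in>E. x \<tau> * cnj (y \<tau>') * (cnj (u \<gamma> \<tau>') * u \<gamma> \<tau>))"
    by (rule sum.swap)
  also have "\<dots> = (\<Sum>\<tau>\<in>E. \<Sum>\<tau>'\<in>E. \<Sum>\<gamma>\<in>E. x \<tau> * cnj (y \<tau>') * (cnj (u \<gamma> \<tau>') * u \<gamma> \<tau>))"
    by (rule sum.cong[OF refl], rule sum.swap)
  also have "\<dots> = (\<Sum>\<tau>\<in>E. \<Sum>\<tau>'\<in>E. x \<tau> * cnj (y \<tau>') * (if \<tau>' = \<tau> then 1 else 0))"
    using u by (intro sum.cong refl) (simp add: unitary_on_def flip: sum_distrib_left)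
  also have "\<dots> = (\<Sum>\<gamma>\<in>E. x \<gamma> * cnj (y \<gamma>))"
    using fin by (simp add: if_distrib[of "\<lambda>t. _ * t"] cong: if_cong)
  finally show ?thesis .
qed

lemma unitary_on_singleton: "unitary_on {e} u \<Longrightarrow> u e e * cnj (u e e) = 1"
  by (simp add: unitary_on_def)

section \<open>Quantum integers\<close>

abbreviation delta :: real ("\<delta>") where "\<delta> \<equiv> qint 2"

definition theta :: real ("\<theta>") where "\<theta> = root 4 3"

lemma theta_pos: "\<theta> > 0" and theta_power4: "\<theta> ^ 4 = 3"
  by (simp_all add: theta_def)

lemma theta_power2: "\<theta>\<^sup>2 = sqrt 3"
proof -
  have "(\<theta>\<^sup>2)\<^sup>2 = 3" using theta_power4 by simp
  then show ?thesis by (metis real_sqrt_unique zero_le_power2)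
qed

lemma qint_eq_sin: "qint m = sin (m * pi / 12) / sin (pi / 12)"
proof -
  have q: "qpar = cis (pi / 12)"
    by (simp add: qpar_def cis_conv_exp)
  have *: "qpar ^ n - inverse qpar ^ n = 2 * \<i> * of_real (sin (n * pi / 12))" for n
    by (simp add: q Complex.DeMoivre complex_eq_iff)
  have "(qpar ^ m - inverse qpar ^ m) / (qpar - inverse qpar)
      = of_real (sin (m * pi / 12) / sin (pi / 12))"
    using *[of m] *[of 1] by simp
  then show ?thesis
    by (simp add: qint_def)
qed

lemma sin_pi_12: "sin (pi / 12) > 0"
  by (rule sin_gt_zero) (auto simp: field_simps)

lemma cos_pi_6: "2 * cos (pi / 6) = \<theta>\<^sup>2"
  by (simp add: theta_power2 cos_30)

lemma delta_eq_cos: "\<delta> = 2 * cos (pi / 12)"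
  using sin_pi_12 sin_double[of "pi / 12"] by (simp add: qint_eq_sin field_simps)

lemma delta_pos: "\<delta> > 0"
  unfolding delta_eq_cos by (simp add: cos_gt_zero)

lemma delta_power2: "\<delta>\<^sup>2 = 2 + \<theta>\<^sup>2"
  using cos_double_cos[of "pi / 12"] cos_pi_6 by (simp add: delta_eq_cos field_simps)

lemma qint_3: "qint 3 = 1 + \<theta>\<^sup>2"
proof -
  have "sin (3 * (pi / 12)) = sin (2 * (pi / 12) + pi / 12)" by (simp add: field_simps)
  also have "\<dots> = sin (pi / 12) * ((2 * cos (pi / 12))\<^sup>2 - 1)"
    unfolding sin_add sin_double cos_double_cos by algebra
  finally show ?thesis
    using sin_pi_12 delta_power2 by (simp add: qint_eq_sin delta_eq_cos[symmetric])
qed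

lemma qint_4: "qint 4 = \<delta> * \<theta>\<^sup>2"
proof -
  have "sin (4 * (pi / 12)) = sin (2 * (2 * (pi / 12)))" by simp
  also have "\<dots> = sin (2 * (pi / 12)) * (2 * cos (2 * (pi / 12)))"
    by (subst sin_double) simp
  finally show ?thesis using sin_pi_12 cos_pi_6 by (simp add: qint_eq_sin)
qed

lemma sqrt_qint_2_qint_4: "sqrt (\<delta> * qint 4) = \<delta> * \<theta>"
  using delta_pos theta_pos
  by (simp add: qint_4 power2_eq_square[symmetric] mult.assoc real_sqrt_mult)

lemma delta_theta_power2: "(\<delta> * \<theta>)\<^sup>2 = 3 + 2 * \<theta>\<^sup>2"
  using delta_power2 theta_power4 by algebra

lemma delta_theta_gt_1: "\<delta> * \<theta> > 1"
  by (rule power2_less_imp_less)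
    (use delta_pos theta_pos in \<open>auto simp: delta_theta_power2 intro: add_pos_pos\<close>)

section \<open>The graph and its Perron-Frobenius eigenvector\<close>

lemma UNIV_idx: "(UNIV :: idx set) = {L1, L2, L3}"
  using idx.exhaust by auto

instance idx :: finite
  by standard (simp add: UNIV_idx)

lemma sum_idx: "(\<Sum>l\<in>UNIV. f l) = f L1 + f L2 + f L3"
  by (simp add: UNIV_idx add.assoc)

lemma UNIV_vertex: "(UNIV :: vertex set) = range VI \<union> range VJ \<union> range VK \<union> {VP, VQ, VR}"
proof (rule set_eqI)
  show "v \<in> UNIV \<longleftrightarrow> v \<in> range VI \<union> range VJ \<union> range VK \<union> {VP, VQ, VR}" for v
    by (cases v) auto
qed

instance vertex :: finite
  by standard (simp add: UNIV_vertex)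

lemma UNIV_edge:
  "(UNIV :: edge set) = range IJ \<union> range JK \<union> range KI \<union> range PJ \<union> range KP \<union> range JR \<union> range QK
     \<union> {QR, Alpha, Alpha', Beta, Beta'}"
proof (rule set_eqI)
  show "e \<in> UNIV \<longleftrightarrow> e \<in> range IJ \<union> range JK \<union> range KI \<union> range PJ \<union> range KP \<union> range JR \<union> range QK
     \<union> {QR, Alpha, Alpha', Beta, Beta'}" for e
    by (cases e) auto
qed

instance edge :: finite
  by standard (simp add: UNIV_edge)

lemma E1_12_simps:
  "verts E1_12 = UNIV" "arcs E1_12 = UNIV" "tail E1_12 = edge_tail" "head E1_12 = edge_head"
  by (simp_all add: E1_12_def)

lemma sum_verts:
  "(\<Sum>v\<in>verts E1_12. f v)
     = (\<Sum>l\<in>UNIV. f (VI l)) + (\<Sum>l\<in>UNIV. f (VJ l)) + (\<Sum>l\<in>UNIV. f (VK l)) + (f VP + f VQ + f VR)"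
proof -
  have "(\<Sum>v\<in>range VI \<union> range VJ \<union> range VK \<union> {VP, VQ, VR}. f v)
      = sum f (range VI) + sum f (range VJ) + sum f (range VK) + (f VP + f VQ + f VR)"
    by (subst sum.union_disjoint, auto)+ (simp add: add.assoc)
  then show ?thesis
    by (simp add: E1_12_def UNIV_vertex sum.reindex inj_def)
qed

lemma edges_E1_12:
  "edges E1_12 (VI l) (VI m) = {}" "edges E1_12 (VI l) (VJ m) = (if m = l then {IJ l} else {})"
  "edges E1_12 (VI l) (VK m) = {}"
  "edges E1_12 (VI l) VP = {}" "edges E1_12 (VI l) VQ = {}" "edges E1_12 (VI l) VR = {}"
  "edges E1_12 (VJ l) (VI m) = {}" "edges E1_12 (VJ l) (VJ m) = {}"
  "edges E1_12 (VJ l) (VK m) = (if m = l then {JK l} else {})"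
  "edges E1_12 (VJ l) VP = {}" "edges E1_12 (VJ l) VQ = {}" "edges E1_12 (VJ l) VR = {JR l}"
  "edges E1_12 (VK l) (VI m) = (if m = l then {KI l} else {})" "edges E1_12 (VK l) (VJ m) = {}"
  "edges E1_12 (VK l) (VK m) = {}"
  "edges E1_12 (VK l) VP = {KP l}" "edges E1_12 (VK l) VQ = {}" "edges E1_12 (VK l) VR = {}"
  "edges E1_12 VP (VI m) = {}" "edges E1_12 VP (VJ m) = {PJ m}" "edges E1_12 VP (VK m) = {}"
  "edges E1_12 VP VP = {}" "edges E1_12 VP VQ = {Beta, Beta'}" "edges E1_12 VP VR = {}"
  "edges E1_12 VQ (VI m) = {}" "edges E1_12 VQ (VJ m) = {}" "edges E1_12 VQ (VK m) = {QK m}"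
  "edges E1_12 VQ VP = {}" "edges E1_12 VQ VQ = {}" "edges E1_12 VQ VR = {QR}"
  "edges E1_12 VR (VI m) = {}" "edges E1_12 VR (VJ m) = {}" "edges E1_12 VR (VK m) = {}"
  "edges E1_12 VR VP = {Alpha, Alpha'}" "edges E1_12 VR VQ = {}" "edges E1_12 VR VR = {}"
  unfolding edges_def E1_12_def by (rule set_eqI, rename_tac e, case_tac e; auto)+

lemma sum_if_empty: "sum f (if b then A else {}) = (if b then sum f A else 0)"
  by simp

lemma sum_idx_delta:
  "(\<Sum>m\<in>UNIV. if m = l then f m else 0) = f (l::idx)"
  "(\<Sum>m\<in>UNIV. if l = m then f m else 0) = f (l::idx)"
  by simp_all

lemma fin_digraph_E1_12: "fin_digraph E1_12"
  by standard (simp_all add: E1_12_simps)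

lemma E1_phi_values:
  "E1_phi (VI l) = 1" "E1_phi (VJ l) = 1 + \<theta>\<^sup>2" "E1_phi (VK l) = 1 + \<theta>\<^sup>2"
  "E1_phi VP = 3 + 2 * \<theta>\<^sup>2" "E1_phi VQ = 3 + \<theta>\<^sup>2" "E1_phi VR = 3 + \<theta>\<^sup>2"
proof -
  have "qint 3 * qint 4 / \<delta> = (1 + \<theta>\<^sup>2) * \<theta>\<^sup>2"
    using delta_pos by (simp add: qint_3 qint_4)
  also have "\<dots> = 3 + \<theta>\<^sup>2" using theta_power4 by (simp add: algebra_simps flip: power_add)
  finally show "E1_phi VQ = 3 + \<theta>\<^sup>2" "E1_phi VR = 3 + \<theta>\<^sup>2" by simp_all
  show "E1_phi VP = 3 + 2 * \<theta>\<^sup>2"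
    using delta_theta_power2 by (simp add: qint_4 power_mult_distrib) (simp add: power2_eq_square)
qed (simp_all add: qint_3)

lemma perron_frobenius_E1_12: "perron_frobenius E1_12 (qint 3) E1_phi"
proof -
  have pos: "E1_phi i > 0" for i
    by (cases i) (simp_all only: E1_phi_values, simp_all add: add_pos_nonneg)
  note sums = sum_verts edges_E1_12 sum_idx E1_phi_values qint_3 theta_power4 algebra_simps
    power_add[symmetric]
  have "(\<Sum>j\<in>verts E1_12. of_nat (card (edges E1_12 i j)) * E1_phi j) = qint 3 * E1_phi i" for i
  proof (cases i)
    case (VI l)
    then show ?thesis by (cases l) (simp_all add: sums del: E1_phi.simps(2-) sum_constant)
  next
    case (VJ l)
    then show ?thesis by (cases l) (simp_all add: sums del: E1_phi.simps(2-) sum_constant)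
  next
    case (VK l)
    then show ?thesis by (cases l) (simp_all add: sums del: E1_phi.simps(2-) sum_constant)
  qed (simp_all add: sums del: E1_phi.simps(2-) sum_constant)
  then have eig: "adj_eigenvector E1_12 (qint 3) E1_phi"
    using pos by (auto simp: adj_eigenvector_def E1_12_simps intro!: exI[of _ VP] less_imp_neq[symmetric])
  show ?thesis
    unfolding perron_frobenius_def
    using eig pos positive_eigenvector_dominates[OF _ eig pos] by (auto simp: E1_12_simps)
qed

section \<open>The cells in closed form\<close>

text \<open>
  The common factor of the cells on the triangles through \<open>p, q, r\<close>; the remaining factor
  \<open>\<delta> \<theta> \<minusplus> s\<close> comes from \<open>(\<delta> \<theta> - s)\<^sup>2 = 2 \<delta> (\<delta> - s \<theta>)\<close>.
\<close>

definition kappa :: real ("\<kappa>") where "\<kappa> = \<theta>\<^sup>2 * sqrt (\<delta> / 2)"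

text \<open>
  The modulus of the cells on the triangles through \<open>p, j\<^sub>l, r\<close> and \<open>p, q, k\<^sub>l\<close>, the nested radical
  \<open>\<surd>[2] \<surd>([2][4] + s \<surd>([2][4]))\<close>; at \<open>s\<close> it belongs to \<open>\<alpha>\<close> and \<open>\<beta>'\<close>, at \<open>- s\<close> to \<open>\<alpha>'\<close> and \<open>\<beta>\<close>.
\<close>

definition amp :: "real \<Rightarrow> real" where "amp s = sqrt (\<delta>\<^sup>2 * \<theta> * (\<delta> * \<theta> + s))"

definition amp_ijk :: real where "amp_ijk = sqrt (\<delta> * qint 3)"

definition amp_pjk :: real where "amp_pjk = sqrt (qint 3 * qint 4)"

lemma abs_sign_le: "(s::real)\<^sup>2 = 1 \<Longrightarrow> \<bar>s\<bar> \<le> \<delta> * \<theta>"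
  using delta_theta_gt_1 by (auto simp: power2_eq_1_iff)

lemma sqrt_eq_amp: "sqrt \<delta> * sqrt (\<delta> * qint 4 + s * sqrt (\<delta> * qint 4)) = amp s"
  unfolding amp_def sqrt_qint_2_qint_4 unfolding qint_4 real_sqrt_mult[symmetric]
  by (rule arg_cong[where f = sqrt]) algebra

lemma sqrt_eq_kappa:
  assumes "s\<^sup>2 = 1"
  shows "qint 4 / sqrt \<delta> * sqrt (\<delta>\<^sup>2 - s * sqrt (\<delta> * qint 4)) = \<kappa> * (\<delta> * \<theta> - s)"
proof -
  have pos: "\<delta> * \<theta> - s \<ge> 0" using abs_sign_le[OF assms] by linarith
  have "\<delta> \<noteq> 0" using delta_pos by simp
  then have "qint 4 / sqrt \<delta> = \<theta>\<^sup>2 * sqrt \<delta>"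
    using delta_pos by (simp add: qint_4 field_simps)
  moreover have "\<delta> * (\<delta>\<^sup>2 - s * (\<delta> * \<theta>)) = (\<delta> / 2) * (\<delta> * \<theta> - s)\<^sup>2"
    using delta_power2 theta_power4 assms by algebra
  then have "sqrt \<delta> * sqrt (\<delta>\<^sup>2 - s * (\<delta> * \<theta>)) = sqrt (\<delta> / 2) * (\<delta> * \<theta> - s)"
    unfolding real_sqrt_mult[symmetric] using pos
    by (simp only: real_sqrt_mult real_sqrt_abs abs_of_nonneg)
  ultimately show ?thesis by (simp add: kappa_def sqrt_qint_2_qint_4)
qed

lemma E1_cells_closed_form:
  assumes "s\<^sup>2 = 1"
  shows
  "E1_cells s (IJ l) (JK l) (KI l) = of_real amp_ijk"
  "E1_cells s (PJ l) (JK l) (KP l) = of_real amp_pjk"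
  "E1_cells s (PJ l) (JR l) Alpha = eps l * of_real (amp s)"
  "E1_cells s (PJ l) (JR l) Alpha' = cnj (eps l) * of_real (amp (- s))"
  "E1_cells s Beta (QK l) (KP l) = eps l * of_real (amp (- s))"
  "E1_cells s Beta' (QK l) (KP l) = cnj (eps l) * of_real (amp s)"
  "E1_cells s Beta' QR Alpha = of_real (\<kappa> * (\<delta> * \<theta> - s))"
  "E1_cells s Beta QR Alpha' = - of_real (\<kappa> * (\<delta> * \<theta> + s))"
  "E1_cells s Beta QR Alpha = 0"
  "E1_cells s Beta' QR Alpha' = 0"
  unfolding E1_cells_values amp_ijk_def amp_pjk_def
  using sqrt_eq_amp[of s] sqrt_eq_amp[of "- s"] sqrt_eq_kappa[of s] sqrt_eq_kappa[of "- s"] assms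
  by simp_all

text \<open>
  Every triangle has exactly one rotation that starts with an edge \<open>i\<^sub>l \<rightarrow> j\<^sub>l\<close>, \<open>p \<rightarrow> j\<^sub>l\<close> or \<open>p \<rightarrow> q\<close>;
  as rewrite rules these equations turn the others into it.
\<close>

lemma E1_cells_normalize:
  "E1_cells s (JK l) b c = E1_cells s c (JK l) b"
  "E1_cells s (JR l) b c = E1_cells s c (JR l) b"
  "E1_cells s (QK l) b c = E1_cells s c (QK l) b"
  "E1_cells s QR b c = E1_cells s c QR b"
  "E1_cells s (KI l) b c = E1_cells s b c (KI l)"
  "E1_cells s (KP l) b c = E1_cells s b c (KP l)"
  "E1_cells s Alpha b c = E1_cells s b c Alpha"
  "E1_cells s Alpha' b c = E1_cells s b c Alpha'"
  by (metis E1_cells_rotate)+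

text \<open>Inverses that are polynomials in \<open>\<theta>\<close> keep the equations of type II free of divisions.\<close>

lemma E1_phi_inverse:
  "inverse (E1_phi (VI l)) = 1"
  "inverse (E1_phi (VJ l)) = (\<theta>\<^sup>2 - 1) / 2" "inverse (E1_phi (VK l)) = (\<theta>\<^sup>2 - 1) / 2"
  "inverse (E1_phi VP) = (2 * \<theta>\<^sup>2 - 3) / 3"
  "inverse (E1_phi VQ) = (3 - \<theta>\<^sup>2) / 6" "inverse (E1_phi VR) = (3 - \<theta>\<^sup>2) / 6"
  unfolding E1_phi_values
  by (rule inverse_unique; use theta_power4 in \<open>simp add: algebra_simps flip: power_add\<close>)+

lemma of_real_weights:
  "complex_of_real (E1_phi (VI l)) = 1"
  "complex_of_real (E1_phi (VJ l)) = 1 + (of_real \<theta>)\<^sup>2"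
  "complex_of_real (E1_phi (VK l)) = 1 + (of_real \<theta>)\<^sup>2"
  "complex_of_real (E1_phi VP) = 3 + 2 * (of_real \<theta>)\<^sup>2"
  "complex_of_real (E1_phi VQ) = 3 + (of_real \<theta>)\<^sup>2"
  "complex_of_real (E1_phi VR) = 3 + (of_real \<theta>)\<^sup>2"
  "complex_of_real (inverse (E1_phi (VI l))) = 1"
  "complex_of_real (inverse (E1_phi (VJ l))) = ((of_real \<theta>)\<^sup>2 - 1) / 2"
  "complex_of_real (inverse (E1_phi (VK l))) = ((of_real \<theta>)\<^sup>2 - 1) / 2"
  "complex_of_real (inverse (E1_phi VP)) = (2 * (of_real \<theta>)\<^sup>2 - 3) / 3"
  "complex_of_real (inverse (E1_phi VQ)) = (3 - (of_real \<theta>)\<^sup>2) / 6"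
  "complex_of_real (inverse (E1_phi VR)) = (3 - (of_real \<theta>)\<^sup>2) / 6"
  unfolding E1_phi_inverse unfolding E1_phi_values by simp_all

lemma amp_power2:
  assumes "s\<^sup>2 = 1"
  shows "(amp s)\<^sup>2 = \<delta>\<^sup>2 * \<theta> * (\<delta> * \<theta> + s)"
proof -
  have "\<delta> * \<theta> + s \<ge> 0" using abs_sign_le[OF assms] by linarith
  then show ?thesis unfolding amp_def using delta_pos theta_pos by simp
qed

lemma cell_relations:
  assumes "s\<^sup>2 = 1"
  shows "(complex_of_real \<delta>)\<^sup>2 = 2 + (of_real \<theta>)\<^sup>2"
    "complex_of_real \<theta> ^ 4 = 3"
    "(complex_of_real s)\<^sup>2 = 1"
    "(complex_of_real amp_ijk)\<^sup>2 = of_real \<delta> * (1 + (of_real \<theta>)\<^sup>2)"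
    "(complex_of_real amp_pjk)\<^sup>2 = of_real \<delta> * (3 + (of_real \<theta>)\<^sup>2)"
    "(complex_of_real \<kappa>)\<^sup>2 = 3 * of_real \<delta> / 2"
    "(complex_of_real (amp s))\<^sup>2 = (of_real \<delta>)\<^sup>2 * of_real \<theta> * (of_real \<delta> * of_real \<theta> + of_real s)"
    "(complex_of_real (amp (- s)))\<^sup>2
       = (of_real \<delta>)\<^sup>2 * of_real \<theta> * (of_real \<delta> * of_real \<theta> - of_real s)"
proof -
  have sq: "amp_ijk\<^sup>2 = \<delta> * (1 + \<theta>\<^sup>2)" "amp_pjk\<^sup>2 = \<delta> * (3 + \<theta>\<^sup>2)" "\<kappa>\<^sup>2 = 3 * \<delta> / 2"
    using delta_pos theta_pos theta_power4
    by (simp_all add: amp_ijk_def amp_pjk_def kappa_def qint_3 qint_4 power_mult_distrib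
        zero_le_mult_iff algebra_simps flip: power_add)
  have amps: "(amp (- s))\<^sup>2 = \<delta>\<^sup>2 * \<theta> * (\<delta> * \<theta> - s)"
    using amp_power2[of "- s"] assms by simp
  show "(complex_of_real \<delta>)\<^sup>2 = 2 + (of_real \<theta>)\<^sup>2" "complex_of_real \<theta> ^ 4 = 3"
    "(complex_of_real s)\<^sup>2 = 1"
    "(complex_of_real amp_ijk)\<^sup>2 = of_real \<delta> * (1 + (of_real \<theta>)\<^sup>2)"
    "(complex_of_real amp_pjk)\<^sup>2 = of_real \<delta> * (3 + (of_real \<theta>)\<^sup>2)"
    "(complex_of_real \<kappa>)\<^sup>2 = 3 * of_real \<delta> / 2"
    "(complex_of_real (amp s))\<^sup>2 = (of_real \<delta>)\<^sup>2 * of_real \<theta> * (of_real \<delta> * of_real \<theta> + of_real s)"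
    "(complex_of_real (amp (- s)))\<^sup>2
       = (of_real \<delta>)\<^sup>2 * of_real \<theta> * (of_real \<delta> * of_real \<theta> - of_real s)"
    unfolding of_real_power[symmetric] delta_power2 theta_power4 sq amps amp_power2[OF assms] assms
    by simp_all
qed

lemma eps_cartesian:
  "eps L1 = 1" "eps L2 = Complex (- 1 / 2) (sqrt 3 / 2)" "eps L3 = Complex (- 1 / 2) (- sqrt 3 / 2)"
proof -
  have "exp (2 * complex_of_real pi * \<i> / 3) = Complex (- 1 / 2) (sqrt 3 / 2)"
    using cos_120 sin_120 by (simp add: complex_eq_iff Re_exp Im_exp)
  then show "eps L1 = 1" "eps L2 = Complex (- 1 / 2) (sqrt 3 / 2)"
      "eps L3 = Complex (- 1 / 2) (- sqrt 3 / 2)"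
    by (simp_all add: complex_eq_iff)
qed

lemma eps_mult_cnj: "eps l * cnj (eps l) = 1"
  by (cases l) (simp_all only: eps_cartesian, simp_all add: complex_eq_iff)

lemma eps_cross: "l \<noteq> m \<Longrightarrow> eps l * cnj (eps m) + eps m * cnj (eps l) = - 1"
  by (cases l; cases m) (simp_all only: eps_cartesian, simp_all add: complex_eq_iff)

lemma eps_L2: "eps L2 + cnj (eps L2) = - 1"
  by (simp only: eps_cartesian) (simp add: complex_eq_iff)

lemma eps_L3: "eps L3 = cnj (eps L2)"
  by (simp only: eps_cartesian) (simp add: complex_eq_iff)

section \<open>The equations of type I and II\<close>

context
  fixes s :: real
  assumes sign: "s\<^sup>2 = 1"
begin

abbreviation "Loop \<equiv> loop_relation E1_12 E1_phi (E1_cells s)"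

abbreviation "Square \<equiv> square_relation E1_12 E1_phi (E1_cells s)"

lemmas expand = E1_12_simps(3,4) sum_verts edges_E1_12 sum_if_empty sum_idx_delta
  E1_cells_normalize E1_cells_closed_form[OF sign] of_real_weights

lemmas loop_expand = loop_relation_def expand
lemmas square_expand = square_relation_def expand

text \<open>
  Evaluating these would replace the polynomial expressions in \<open>\<theta>\<close> and the cube roots of unity by quotients
  of quantum integers and by exponentials.
\<close>

lemmas keep_symbolic = E1_phi.simps of_real_inverse eps.simps(2,3)

text \<open>
  In each configuration the simplifier enumerates the paths that close the square; \<open>algebra\<close> then
  reduces the resulting polynomial identity modulo the relations between the constants. Where
  the simplifier has cancelled a common factor it leaves a disjunction, whose last disjunct is
  the identity that remains.
\<close>

lemma loop_simple_edge:
  "Loop (IJ l) (IJ l)" "Loop (JK l) (JK l)" "Loop (KI l) (KI l)" "Loop (PJ l) (PJ l)"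
  "Loop (KP l) (KP l)" "Loop (JR l) (JR l)" "Loop (QK l) (QK l)"
  by (simp add: loop_expand del: keep_symbolic;
      use cell_relations[OF sign] eps_mult_cnj[of l] in algebra)+

lemma loop_double_edge:
  "Loop QR QR"
  "Loop Alpha Alpha" "Loop Alpha Alpha'" "Loop Alpha' Alpha" "Loop Alpha' Alpha'"
  "Loop Beta Beta" "Loop Beta Beta'" "Loop Beta' Beta" "Loop Beta' Beta'"
  by (simp add: loop_expand sum_idx eps_L3 del: keep_symbolic;
      use cell_relations[OF sign] eps_L2 eps_mult_cnj[of L2] in algebra)+

lemma square_simple_edge:
  "Square (IJ l) (IJ l) (IJ l) (IJ l)" "Square (JK l) (JK l) (JK l) (JK l)"
  "Square (KI l) (KI l) (KI l) (KI l)" "Square (PJ l) (PJ l) (PJ l) (PJ l)"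
  "Square (KP l) (KP l) (KP l) (KP l)" "Square (JR l) (JR l) (JR l) (JR l)"
  "Square (QK l) (QK l) (QK l) (QK l)" "Square QR QR QR QR"
  by (simp add: square_expand del: keep_symbolic;
      use cell_relations[OF sign] eps_mult_cnj[of l] in algebra)+

lemma square_Alpha:
  "Square Alpha Alpha Alpha Alpha" "Square Alpha Alpha Alpha Alpha'"
  "Square Alpha Alpha Alpha' Alpha" "Square Alpha Alpha Alpha' Alpha'"
  "Square Alpha Alpha' Alpha Alpha" "Square Alpha Alpha' Alpha Alpha'"
  "Square Alpha Alpha' Alpha' Alpha" "Square Alpha Alpha' Alpha' Alpha'"
  "Square Alpha' Alpha Alpha Alpha" "Square Alpha' Alpha Alpha Alpha'"
  "Square Alpha' Alpha Alpha' Alpha" "Square Alpha' Alpha Alpha' Alpha'"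
  "Square Alpha' Alpha' Alpha Alpha" "Square Alpha' Alpha' Alpha Alpha'"
  "Square Alpha' Alpha' Alpha' Alpha" "Square Alpha' Alpha' Alpha' Alpha'"
  by (simp add: square_expand sum_idx eps_L3 del: keep_symbolic;
      use cell_relations[OF sign] eps_L2 eps_mult_cnj[of L2] in algebra)+

lemma square_Beta:
  "Square Beta Beta Beta Beta" "Square Beta Beta Beta Beta'"
  "Square Beta Beta Beta' Beta" "Square Beta Beta Beta' Beta'"
  "Square Beta Beta' Beta Beta" "Square Beta Beta' Beta Beta'"
  "Square Beta Beta' Beta' Beta" "Square Beta Beta' Beta' Beta'"
  "Square Beta' Beta Beta Beta" "Square Beta' Beta Beta Beta'"
  "Square Beta' Beta Beta' Beta" "Square Beta' Beta Beta' Beta'"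
  "Square Beta' Beta' Beta Beta" "Square Beta' Beta' Beta Beta'"
  "Square Beta' Beta' Beta' Beta" "Square Beta' Beta' Beta' Beta'"
  by (simp add: square_expand sum_idx eps_L3 del: keep_symbolic;
      use cell_relations[OF sign] eps_L2 eps_mult_cnj[of L2] in algebra)+

lemma square_common_source:
  "Square (JK l) (JK l) (JR l) (JR l)" "Square (JR l) (JR l) (JK l) (JK l)"
  "Square (KI l) (KI l) (KP l) (KP l)" "Square (KP l) (KP l) (KI l) (KI l)"
  "Square (QK l) (QK l) QR QR" "Square QR QR (QK l) (QK l)"
  by (simp add: square_expand del: keep_symbolic;
      use cell_relations[OF sign] eps_mult_cnj[of l] in algebra)+

lemma square_common_source_Beta:
  "Square (PJ l) (PJ l) Beta Beta" "Square Beta Beta (PJ l) (PJ l)"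
  "Square (PJ l) (PJ l) Beta Beta'" "Square Beta Beta' (PJ l) (PJ l)"
  "Square (PJ l) (PJ l) Beta' Beta" "Square Beta' Beta (PJ l) (PJ l)"
  "Square (PJ l) (PJ l) Beta' Beta'" "Square Beta' Beta' (PJ l) (PJ l)"
  by (simp add: square_expand del: keep_symbolic; (intro disjI2)?;
      use cell_relations[OF sign] eps_mult_cnj[of l] in algebra)+

lemma square_common_source_labels:
  "Square (PJ l) (PJ l) (PJ m) (PJ m)" "Square (QK l) (QK l) (QK m) (QK m)"
proof -
  have "Square (PJ l) (PJ l) (PJ m) (PJ m) \<and> Square (QK l) (QK l) (QK m) (QK m)" if "l \<noteq> m"
    by (intro conjI; simp add: square_expand that that[symmetric] del: keep_symbolic;
        use cell_relations[OF sign] eps_mult_cnj[of l] eps_mult_cnj[of m] eps_cross[OF that]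
          in algebra)
  then show "Square (PJ l) (PJ l) (PJ m) (PJ m)" "Square (QK l) (QK l) (QK m) (QK m)"
    using square_simple_edge by blast+
qed

lemma square_common_target:
  "Square (IJ l) (PJ l) (PJ l) (IJ l)" "Square (PJ l) (IJ l) (IJ l) (PJ l)"
  "Square (JK l) (QK l) (QK l) (JK l)" "Square (QK l) (JK l) (JK l) (QK l)"
  "Square (JR l) QR QR (JR l)" "Square QR (JR l) (JR l) QR"
  by (simp add: square_expand del: keep_symbolic;
      use cell_relations[OF sign] eps_mult_cnj[of l] in algebra)+

lemma square_common_target_Alpha:
  "Square (KP l) Alpha Alpha (KP l)" "Square Alpha (KP l) (KP l) Alpha"
  "Square (KP l) Alpha Alpha' (KP l)" "Square Alpha (KP l) (KP l) Alpha'"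
  "Square (KP l) Alpha' Alpha (KP l)" "Square Alpha' (KP l) (KP l) Alpha"
  "Square (KP l) Alpha' Alpha' (KP l)" "Square Alpha' (KP l) (KP l) Alpha'"
  by (simp add: square_expand del: keep_symbolic; (intro disjI2)?;
      use cell_relations[OF sign] eps_mult_cnj[of l] in algebra)+

lemma square_common_target_labels:
  "Square (KP l) (KP m) (KP m) (KP l)" "Square (JR l) (JR m) (JR m) (JR l)"
proof -
  have "Square (KP l) (KP m) (KP m) (KP l) \<and> Square (JR l) (JR m) (JR m) (JR l)" if "l \<noteq> m"
    by (intro conjI; simp add: square_expand that that[symmetric] del: keep_symbolic;
        use cell_relations[OF sign] eps_mult_cnj[of l] eps_mult_cnj[of m] eps_cross[OF that]
          in algebra)
  then show "Square (KP l) (KP m) (KP m) (KP l)" "Square (JR l) (JR m) (JR m) (JR l)"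
    using square_simple_edge by blast+
qed

text \<open>
  The only squares with four distinct vertices. Both sides vanish, by the identity
  \<open>(amp s)\<^sup>2 (\<delta> \<theta> - s) = (amp (- s))\<^sup>2 (\<delta> \<theta> + s)\<close>: this is where the opposite signs of the two cells on
  the triangles through \<open>p, q, r\<close> are needed.
\<close>

lemma square_four_vertices:
  "Square (JK l) (QK l) QR (JR l)" "Square (QK l) (JK l) (JR l) QR"
  "Square (JR l) QR (QK l) (JK l)" "Square QR (JR l) (JK l) (QK l)"
  by (simp add: square_expand del: keep_symbolic; (intro disjI2)?;
      use cell_relations[OF sign] eps_mult_cnj[of l] in algebra)+

lemma type_I_E1_cells: "type_I E1_12 E1_phi (E1_cells s)"
proof (rule type_I_if_loop_relations, unfold E1_12_simps)
  fix a b
  assume "edge_tail a = edge_tail b" "edge_head a = edge_head b"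
  then show "Loop a b"
    by (cases a; cases b; simp add: loop_simple_edge loop_double_edge)
qed

lemma type_II_E1_cells: "type_II E1_12 E1_phi (E1_cells s)"
proof (rule type_II_if_square_relations, unfold E1_12_simps)
  fix a b c d
  assume sq: "edge_head a = edge_head b" "edge_tail b = edge_tail c"
    "edge_head c = edge_head d" "edge_tail d = edge_tail a"
  note configurations = square_simple_edge square_Alpha square_Beta square_common_source
    square_common_source_Beta square_common_source_labels square_common_target
    square_common_target_Alpha square_common_target_labels square_four_vertices
  show "Square a b c d"
    using sq by (cases a; cases b; simp; cases c; simp; cases d; simp add: configurations)
qed

lemma cell_system_E1_cells: "cell_system E1_12 E1_phi (E1_cells s)"
  unfolding cell_system_def rotation_invariant_def
  using fin_digraph_E1_12 perron_frobenius_E1_12 type_I_E1_cells type_II_E1_cells E1_cells_rotate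
  by blast

end

section \<open>A Bargmann invariant\<close>

text \<open>
  The Gram matrix of the three vectors \<open>w\<^sub>l \<in> \<complex>\<^sup>2\<close>: passing to inner products removes the unitary matrix
  on the double edge from \<open>r\<close> to \<open>p\<close>.
\<close>

definition gram :: "edge cells \<Rightarrow> idx \<Rightarrow> idx \<Rightarrow> complex" where
  "gram W l m = (\<Sum>\<gamma>\<in>{Alpha, Alpha'}. W (PJ l) (JR l) \<gamma> * cnj (W (PJ m) (JR m) \<gamma>))"

definition bargmann :: "edge cells \<Rightarrow> complex" where
  "bargmann W = gram W L1 L2 * gram W L2 L3 * gram W L3 L1"

text \<open>
  The inner product of \<open>w\<^sub>l\<close> and \<open>w\<^sub>m\<close> changes by \<open>c\<^sub>l\<close> times the conjugate of \<open>c\<^sub>m\<close>, with phases \<open>c\<^sub>l\<close> coming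
  from the simple edges \<open>p \<rightarrow> j\<^sub>l\<close> and \<open>j\<^sub>l \<rightarrow> r\<close>; around the cycle \<open>1, 2, 3\<close> they cancel.
\<close>

lemma bargmann_invariant:
  assumes "cells_equivalent E1_12 W1 W2"
  shows "bargmann W1 = bargmann W2"
proof -
  obtain u where unitary: "\<And>i j. unitary_on (edges E1_12 i j) (u i j)"
    and transform: "\<And>i j k \<sigma> \<rho> \<gamma>. \<sigma> \<in> edges E1_12 i j \<Longrightarrow> \<rho> \<in> edges E1_12 j k \<Longrightarrow>
      \<gamma> \<in> edges E1_12 k i \<Longrightarrow> W1 \<sigma> \<rho> \<gamma> =
        (\<Sum>\<sigma>'\<in>edges E1_12 i j. \<Sum>\<rho>'\<in>edges E1_12 j k. \<Sum>\<gamma>'\<in>edges E1_12 k i.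
           u i j \<sigma> \<sigma>' * u j k \<rho> \<rho>' * u k i \<gamma> \<gamma>' * W2 \<sigma>' \<rho>' \<gamma>')"
    using assms unfolding cells_equivalent_def E1_12_simps by fast
  define c where "c l = u VP (VJ l) (PJ l) (PJ l) * u (VJ l) VR (JR l) (JR l)" for l
  define v where "v = u VR VP"
  have phase: "c l * cnj (c l) = 1" for l
    using unitary_on_singleton[of "PJ l" "u VP (VJ l)"] unitary_on_singleton[of "JR l" "u (VJ l) VR"]
      unitary[of VP "VJ l"] unitary[of "VJ l" VR]
    by (simp add: c_def edges_E1_12) algebra
  have v: "unitary_on {Alpha, Alpha'} v"
    using unitary[of VR VP] by (simp add: v_def edges_E1_12)
  have cells: "W1 (PJ l) (JR l) \<gamma> = c l * (\<Sum>\<tau>\<in>{Alpha, Alpha'}. v \<gamma> \<tau> * W2 (PJ l) (JR l) \<tau>)"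
    if "\<gamma> \<in> {Alpha, Alpha'}" for l \<gamma>
    using transform[of "PJ l" VP "VJ l" "JR l" VR \<gamma>] that
    by (simp add: edges_E1_12 c_def v_def algebra_simps)
  have gram: "gram W1 l m = c l * cnj (c m) * gram W2 l m" for l m
  proof -
    have "gram W1 l m = (\<Sum>\<gamma>\<in>{Alpha, Alpha'}. c l * cnj (c m) *
        ((\<Sum>\<tau>\<in>{Alpha, Alpha'}. v \<gamma> \<tau> * W2 (PJ l) (JR l) \<tau>) *
         cnj (\<Sum>\<tau>\<in>{Alpha, Alpha'}. v \<gamma> \<tau> * W2 (PJ m) (JR m) \<tau>)))"
      unfolding gram_def by (intro sum.cong refl) (simp only: cells complex_cnj_mult ac_simps)
    also have "\<dots> = c l * cnj (c m) * gram W2 l m"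
      unfolding sum_distrib_left[symmetric] gram_def
      by (subst unitary_on_preserves_inner[OF _ v]) simp_all
    finally show ?thesis .
  qed
  show ?thesis
    unfolding bargmann_def gram using phase[of L1] phase[of L2] phase[of L3] by algebra
qed

text \<open>
  Consecutive labels have the ratio \<open>\<epsilon>\<^sub>l / \<epsilon>\<^sub>m = e\<^bsup>-2\<pi>\<i>/3\<^esup>\<close>, so the three inner products in the invariant
  coincide.
\<close>

lemma gram_E1_cells:
  assumes "s\<^sup>2 = 1" and "(l, m) \<in> {(L1, L2), (L2, L3), (L3, L1)}"
  shows "gram (E1_cells s) l m = - of_real (\<delta>\<^sup>2 * \<theta>) * Complex (\<delta> * \<theta>) (sqrt 3 * s)"
proof -
  have ratio: "eps l * cnj (eps m) = Complex (- 1 / 2) (- sqrt 3 / 2)"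
    using assms(2) by (auto simp only: insert_iff prod.inject empty_iff eps_cartesian)
      (simp_all add: complex_eq_iff)
  then have ratio': "cnj (eps l) * eps m = Complex (- 1 / 2) (sqrt 3 / 2)"
    by (metis complex_cnj complex_cnj_cnj complex_cnj_mult minus_divide_left minus_minus)
  have amps: "(amp (- s))\<^sup>2 = \<delta>\<^sup>2 * \<theta> * (\<delta> * \<theta> - s)"
    using amp_power2[of "- s"] assms(1) by simp
  have "gram (E1_cells s) l m
      = (eps l * cnj (eps m)) * of_real ((amp s)\<^sup>2) + (cnj (eps l) * eps m) * of_real ((amp (- s))\<^sup>2)"
    by (simp add: gram_def E1_cells_closed_form[OF assms(1)] power2_eq_square)
  also have "\<dots> = - of_real (\<delta>\<^sup>2 * \<theta>) * Complex (\<delta> * \<theta>) (sqrt 3 * s)"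
    unfolding ratio ratio' amps amp_power2[OF assms(1)]
    by (simp add: complex_eq_iff algebra_simps)
  finally show ?thesis .
qed

lemma bargmann_E1_cells:
  assumes "s\<^sup>2 = 1"
  shows "bargmann (E1_cells s) = - of_real ((\<delta>\<^sup>2 * \<theta>) ^ 3) * Complex (\<delta> * \<theta>) (sqrt 3 * s) ^ 3"
  unfolding bargmann_def using assms
  by (simp add: gram_E1_cells power3_eq_cube algebra_simps)

text \<open>
  The imaginary parts of the two invariants are opposite multiples of \<open>(\<delta> \<theta>)\<^sup>2 - 1\<close>, because
  \<open>Im (a + \<i> \<surd>3)\<^sup>3 = 3 \<surd>3 (a\<^sup>2 - 1)\<close>.
\<close>

lemma not_equivalent: "\<not> cells_equivalent E1_12 W_plus W_minus"
proof
  assume "cells_equivalent E1_12 W_plus W_minus"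
  then have "bargmann (E1_cells 1) = bargmann (E1_cells (- 1))"
    unfolding W_plus_def W_minus_def by (rule bargmann_invariant)
  moreover have "\<delta>\<^sup>2 * \<theta> \<noteq> 0" using delta_pos theta_pos by simp
  ultimately have "Complex (\<delta> * \<theta>) (sqrt 3) ^ 3 = Complex (\<delta> * \<theta>) (- sqrt 3) ^ 3"
    by (simp add: bargmann_E1_cells)
  then have "Im (Complex (\<delta> * \<theta>) (sqrt 3) ^ 3) = Im (Complex (\<delta> * \<theta>) (- sqrt 3) ^ 3)"
    by simp
  then have "sqrt 3 * ((\<delta> * \<theta>)\<^sup>2 - 1) = 0"
    by (simp add: power3_eq_cube power2_eq_square algebra_simps)
  then have "(\<delta> * \<theta>)\<^sup>2 = 1" by simp
  then show False
    using delta_theta_gt_1 by (simp add: power2_eq_1_iff)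
qed

theorem theorem12p1:
  shows "cell_system E1_12 E1_phi W_plus
       \<and> cell_system E1_12 E1_phi W_minus
       \<and> \<not> cells_equivalent E1_12 W_plus W_minus"
  using cell_system_E1_cells not_equivalent by (simp add: W_plus_def W_minus_def)

end
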